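(* Let $E$ be a finite-dimensional real Hilbert space and let $A\subseteq E$ be a compact and convex set with a differentiable boundary and with $0\in\operatorname{int}_E(A)$. Then for every linear subspace $\mathcal{V}\neq\{0\}$ of $E$, with orthogonal projection $p_{\mathcal{V}}$ onto $\mathcal{V}$, the following equality holds: $$p_{\mathcal{V}}(A)=\left\{x_{\mathcal{V}}\in\mathcal{V} \;:\; \exists\, x_{\mathcal{V}^\perp}\in\mathcal{V}^\perp \text{ such that } \eta_A(x_{\mathcal{V}},x_{\mathcal{V}^\perp})\le 1 \text{ and } \left(x_{\mathcal{V}}+x_{\mathcal{V}^\perp}\neq 0 \Rightarrow \frac{\partial\eta_A}{\partial x_{\mathcal{V}^\perp}}(x_{\mathcal{V}},x_{\mathcal{V}^\perp})=0\right)\right\}.$$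
   Context: $\operatorname{int}_E(A)$ is the interior of $A$ in $E$. The Minkowski functional of $A$ is $\mu_A:E\to[0,+\infty)$, $\mu_A(x)=\inf\{t>0 : x\in tA\}$. The set $A$ is said to have a differentiable boundary if $\mu_A$ is continuously differentiable on $E\setminus\{0\}$. $\mathcal{V}^\perp$ is the orthogonal complement of $\mathcal{V}$ in $E$. Every $x\in E$ is written uniquely as $x=x_{\mathcal{V}}+x_{\mathcal{V}^\perp}$ with $x_{\mathcal{V}}\in\mathcal{V}$, $x_{\mathcal{V}^\perp}\in\mathcal{V}^\perp$, and $p_{\mathcal{V}}(x)=x_{\mathcal{V}}$. The function $\eta_A:\mathcal{V}\times\mathcal{V}^\perp\to\mathbb{R}$ is defined by $\eta_A(x_{\mathcal{V}},x_{\mathcal{V}^\perp})=\mu_A(x_{\mathcal{V}}+x_{\mathcal{V}^\perp})$, and $\frac{\partial\eta_A}{\partial x_{\mathcal{V}^\perp}}$ denotes its partial derivative with respect to the second variable $x_{\mathcal{V}^\perp}\in\mathcal{V}^\perp$ (a linear form on $\mathcal{V}^\perp$). *)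

theory Defs
  imports "HOL-Analysis.Analysis"
begin

(* The infimum is over a nonempty set as soon as 0 is an interior point of A;
   Inf {} has no specified value in type real. *)
definition minkowski_functional :: "'a::real_vector set \<Rightarrow> 'a \<Rightarrow> real" where
  "minkowski_functional A x = Inf {t. t > 0 \<and> x \<in> (\<lambda>a. t *\<^sub>R a) ` A}"

(* Continuity of the derivative is with respect to the operator norm. *)
definition differentiable_boundary :: "'a::real_normed_vector set \<Rightarrow> bool" where
  "differentiable_boundary A \<longleftrightarrow>
     (\<exists>D :: 'a \<Rightarrow> 'a \<Rightarrow>\<^sub>L real.
        (\<forall>x. x \<noteq> 0 \<longrightarrow> (minkowski_functional A has_derivative blinfun_apply (D x)) (at x)) \<and>
        continuous_on (UNIV - {0}) D)"

definition orth_proj :: "'a::euclidean_space set \<Rightarrow> 'a \<Rightarrow> 'a" where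
  "orth_proj V x = (THE v. v \<in> V \<and> (\<exists>w \<in> V\<^sup>\<bottom>. x = v + w))"

lemma orth_decomp_ex1:
  fixes V :: "'a::euclidean_space set"
  assumes "subspace V"
  shows "\<exists>!v. v \<in> V \<and> (\<exists>w \<in> V\<^sup>\<bottom>. x = v + w)"
proof -
  have span: "span V = V" "span (V\<^sup>\<bottom>) = V\<^sup>\<bottom>"
    using assms by (simp_all add: span_eq_iff subspace_orthogonal_comp)
  obtain v w where vw: "v \<in> span V" "\<And>u. u \<in> span V \<Longrightarrow> orthogonal w u" "x = v + w"
    using orthogonal_subspace_decomp_exists[of V x] by blast
  have w: "w \<in> V\<^sup>\<bottom>"
    using vw(2) span(1) by (auto simp: orthogonal_comp_def orthogonal_commute)
  have orth: "\<And>a b. \<lbrakk>a \<in> V; b \<in> V\<^sup>\<bottom>\<rbrakk> \<Longrightarrow> orthogonal a b"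
    by (auto simp: orthogonal_comp_def)
  show ?thesis
  proof (rule ex1I[of _ v])
    show "v \<in> V \<and> (\<exists>w \<in> V\<^sup>\<bottom>. x = v + w)"
      using vw w span by auto
  next
    fix v' assume "v' \<in> V \<and> (\<exists>w \<in> V\<^sup>\<bottom>. x = v' + w)"
    then obtain w' where "v' \<in> V" "w' \<in> V\<^sup>\<bottom>" "v' + w' = v + w"
      using vw(3) by auto
    then show "v' = v"
      using orthogonal_subspace_decomp_unique[of v' w' v w V "V\<^sup>\<bottom>"] vw(1) w span orth by auto
  qed
qed

(* Of interest on the product of V and its orthogonal complement only; the
   partial derivative in the second variable is accordingly taken within the
   orthogonal complement. *)
definition eta :: "'a::real_vector set \<Rightarrow> 'a \<times> 'a \<Rightarrow> real" where
  "eta A = (\<lambda>(v, w). minkowski_functional A (v + w))"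

end

theory Submission
  imports Defs
begin

text \<open>
  The set \<open>A\<close> is the sublevel set \<open>\<mu> \<le> 1\<close> of its Minkowski functional \<open>\<mu>\<close>
  (\<open>minkowski_functional_le_1_iff\<close>). A point \<open>v\<close> of \<open>V\<close> therefore lies in the projection of \<open>A\<close>
  exactly when \<open>\<mu>\<close> takes a value at most \<open>1\<close> on the affine fibre \<open>v + V\<^sup>\<bottom>\<close>, and this already
  gives the inclusion from right to left.

  For the other inclusion, the value at most \<open>1\<close> has to be attained at a critical point of \<open>\<mu>\<close>
  restricted to the fibre, and the natural candidate is a minimiser. If \<open>v = 0\<close>, the minimiser is
  the origin, where no condition on the derivative is imposed. If \<open>v \<noteq> 0\<close>, the fibre avoids
  the origin, so \<open>\<mu>\<close> is differentiable at each of its points. The part of the fibre inside \<open>A\<close> is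
  compact and nonempty, so \<open>\<mu>\<close> has a minimiser there; outside \<open>A\<close> the values of \<open>\<mu>\<close> exceed
  \<open>1\<close>, so it minimises \<open>\<mu>\<close> over the whole fibre. By Fermat's rule the partial derivative along
  \<open>V\<^sup>\<bottom>\<close> vanishes at that point (\<open>has_derivative_zero_at_min_on_subspace\<close>).
\<close>

lemma orth_proj_eqI:
  fixes V :: "'a::euclidean_space set"
  assumes "subspace V" "v \<in> V" "w \<in> V\<^sup>\<bottom>"
  shows "orth_proj V (v + w) = v"
  unfolding orth_proj_def
  using assms by (intro the1_equality orth_decomp_ex1) auto

lemma convex_scaleR_mem:
  fixes A :: "'a::real_vector set"
  assumes "convex A" "0 \<in> A" "a \<in> A" "0 \<le> c" "c \<le> 1"
  shows "c *\<^sub>R a \<in> A"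
  using convexD[OF assms(1) assms(3) assms(2), of c "1 - c"] assms(4,5) by simp

text \<open>
  The dilations \<open>t A\<close> cover the whole space, which makes the infimum defining the Minkowski
  functional an infimum over a nonempty set.
\<close>

lemma absorbing_of_zero_interior:
  fixes A :: "'a::real_normed_vector set"
  assumes "0 \<in> interior A"
  shows "{t. t > 0 \<and> x \<in> (\<lambda>a. t *\<^sub>R a) ` A} \<noteq> {}"
proof -
  obtain r where r: "r > 0" "ball 0 r \<subseteq> A"
    using assms by (auto simp: mem_interior)
  define t where "t = (norm x + 1) / r"
  have t: "t > 0"
    using r(1) by (simp add: t_def add_nonneg_pos)
  have "norm x < t * r"
    using r(1) by (simp add: t_def)
  then have "x /\<^sub>R t \<in> ball 0 r"
    using t by (simp add: field_simps)
  then have "x /\<^sub>R t \<in> A"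
    using r(2) by blast
  moreover have "x = t *\<^sub>R (x /\<^sub>R t)"
    using t by simp
  ultimately show ?thesis
    using t by blast
qed

text \<open>
  If \<open>\<mu> x \<le> 1\<close>, then \<open>x \<in> t A\<close> for values of \<open>t\<close> arbitrarily close to \<open>1\<close> or below it, and
  convexity puts \<open>c x\<close> in \<open>A\<close> for every \<open>c < 1\<close>; letting \<open>c\<close> tend to \<open>1\<close> and using closedness
  gives \<open>x \<in> A\<close>.
\<close>

lemma minkowski_functional_le_1_iff:
  fixes A :: "'a::real_normed_vector set"
  assumes "closed A" "convex A" "0 \<in> interior A"
  shows "minkowski_functional A x \<le> 1 \<longleftrightarrow> x \<in> A"
proof
  assume "x \<in> A"
  then show "minkowski_functional A x \<le> 1"
    unfolding minkowski_functional_def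
    by (intro cInf_lower) (auto intro!: bdd_belowI[of _ 0] image_eqI[of _ _ x])
next
  assume le: "minkowski_functional A x \<le> 1"
  have 0: "0 \<in> A"
    using assms(3) interior_subset by blast
  have scaled: "c *\<^sub>R x \<in> A" if c: "0 \<le> c" "c < 1" for c
  proof (cases "c = 0")
    case False
    with c have "c > 0"
      by simp
    then have "minkowski_functional A x < 1 / c"
      using le c by (smt (verit) less_divide_eq_1_pos)
    then obtain t a where t: "t > 0" "t < 1 / c" "a \<in> A" "x = t *\<^sub>R a"
      unfolding minkowski_functional_def
      using cInf_lessD[OF absorbing_of_zero_interior[OF assms(3), of x]] by blast
    have "c * t \<le> 1"
      using t(2) \<open>c > 0\<close> by (simp add: field_simps)
    then have "(c * t) *\<^sub>R a \<in> A"
      using t \<open>c > 0\<close> by (intro convex_scaleR_mem[OF assms(2) 0]) auto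
    then show ?thesis
      using t(4) by simp
  qed (use 0 in simp)
  have "(\<lambda>n. (1 - inverse (real (Suc n))) *\<^sub>R x) \<longlonglongrightarrow> (1 - 0) *\<^sub>R x"
    by (intro tendsto_intros LIMSEQ_inverse_real_of_nat)
  moreover have "(1 - inverse (real (Suc n))) *\<^sub>R x \<in> A" for n
    by (rule scaled) (simp_all add: inverse_le_1_iff)
  ultimately show "x \<in> A"
    using closed_sequentially[OF assms(1), of "\<lambda>n. (1 - inverse (real (Suc n))) *\<^sub>R x"] by simp
qed

text \<open>
  Fermat's rule on each line through \<open>w\<close> in a direction of \<open>W\<close> shows that the full derivative
  vanishes on \<open>W\<close>. It need not vanish elsewhere, but the derivative within \<open>W\<close> only tests
  increments lying in \<open>W\<close>, so there the zero map is a derivative as well.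
\<close>

lemma has_derivative_zero_at_min_on_subspace:
  fixes f :: "'a::real_normed_vector \<Rightarrow> real"
  assumes "subspace W" "w \<in> W"
    and deriv: "(f has_derivative D) (at w)"
    and min: "\<And>z. z \<in> W \<Longrightarrow> f w \<le> f z"
  shows "(f has_derivative (\<lambda>h. 0)) (at w within W)"
proof -
  have D0: "D h = 0" if "h \<in> W" for h
  proof -
    have "((\<lambda>t. f (w + t *\<^sub>R h)) has_derivative (\<lambda>t. D (t *\<^sub>R h))) (at 0)"
      by (rule has_derivative_compose[where g = f])
        (auto intro!: derivative_eq_intros simp: deriv)
    moreover have "(\<lambda>t. D (t *\<^sub>R h)) = (*) (D h)"
      using has_derivative_linear[OF deriv] by (auto simp: linear_scale)
    ultimately have "((\<lambda>t. f (w + t *\<^sub>R h)) has_real_derivative D h) (at 0)"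
      by (simp add: has_field_derivative_def)
    moreover have "f (w + 0 *\<^sub>R h) \<le> f (w + t *\<^sub>R h)" for t
      using assms(1,2) that by (simp add: min subspace_add subspace_scale)
    ultimately show ?thesis
      by (intro DERIV_local_min[where d = 1]) auto
  qed
  have "D (z - w) = 0" if "z \<in> W" for z
    using D0 assms(1,2) that by (simp add: subspace_diff)
  then show ?thesis
    using has_derivative_at_withinI[OF deriv, of W]
    by (simp add: has_derivative_within_alt)
qed

text \<open>
  Compactness yields a minimiser only over \<open>A \<inter> S\<close>. It minimises over all of \<open>S\<close> because the
  Minkowski functional is at most \<open>1\<close> on \<open>A\<close> and larger than \<open>1\<close> off \<open>A\<close>.
\<close>

lemma minkowski_functional_min_on_closed:
  fixes A S :: "'a::real_normed_vector set"
  assumes "compact A" "convex A" "0 \<in> interior A" "closed S" "A \<inter> S \<noteq> {}"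
    and "continuous_on (A \<inter> S) (minkowski_functional A)"
  obtains y where "y \<in> A \<inter> S" "\<And>z. z \<in> S \<Longrightarrow> minkowski_functional A y \<le> minkowski_functional A z"
proof -
  have le1: "minkowski_functional A x \<le> 1 \<longleftrightarrow> x \<in> A" for x
    using assms(1-3) by (simp add: minkowski_functional_le_1_iff compact_imp_closed)
  obtain y where y: "y \<in> A \<inter> S"
      "\<forall>z \<in> A \<inter> S. minkowski_functional A y \<le> minkowski_functional A z"
    using continuous_attains_inf[OF compact_Int_closed[OF assms(1,4)] assms(5,6)] by blast
  show thesis
  proof (rule that[OF y(1)])
    fix z assume "z \<in> S"
    then show "minkowski_functional A y \<le> minkowski_functional A z"
      using y le1[of y] le1[of z] by (cases "z \<in> A") auto
  qed
qed

theorem theorem4p1: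
  fixes A V :: "'a::euclidean_space set"
  assumes "compact A"
    and "convex A"
    and "differentiable_boundary A"
    and "0 \<in> interior A"
    and "subspace V"
    and "V \<noteq> {0}"
  shows "orth_proj V ` A =
    {v \<in> V. \<exists>w \<in> V\<^sup>\<bottom>. eta A (v, w) \<le> 1 \<and>
       (v + w \<noteq> 0 \<longrightarrow> ((\<lambda>z. eta A (v, z)) has_derivative (\<lambda>h. 0)) (at w within V\<^sup>\<bottom>))}"
    (is "_ = ?R")
proof
  let ?mu = "minkowski_functional A"
  have le1: "?mu x \<le> 1 \<longleftrightarrow> x \<in> A" for x
    using assms(1,2,4) by (simp add: minkowski_functional_le_1_iff compact_imp_closed)
  have W: "subspace (V\<^sup>\<bottom>)"
    by (rule subspace_orthogonal_comp)
  show "?R \<subseteq> orth_proj V ` A"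
  proof
    fix v assume "v \<in> ?R"
    then obtain w where "v \<in> V" "w \<in> V\<^sup>\<bottom>" "v + w \<in> A"
      by (auto simp: eta_def le1)
    then show "v \<in> orth_proj V ` A"
      using orth_proj_eqI[OF assms(5)] by (metis imageI)
  qed
  show "orth_proj V ` A \<subseteq> ?R"
  proof (rule image_subsetI)
    fix x assume "x \<in> A"
    obtain v w where vw: "v \<in> V" "w \<in> V\<^sup>\<bottom>" "x = v + w"
      using orth_decomp_ex1[OF assms(5), of x] by blast
    have "v \<in> ?R"
    proof (cases "v = 0")
      case True
      have "?mu 0 \<le> 1"
        using le1 assms(4) interior_subset by blast
      then show ?thesis
        using True vw(1) subspace_0[OF W] by (auto simp: eta_def intro!: bexI[of _ 0])
    next
      case False
      obtain D where D: "\<And>y. y \<noteq> 0 \<Longrightarrow> (?mu has_derivative blinfun_apply (D y)) (at y)"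
        using assms(3) unfolding differentiable_boundary_def by blast
      let ?S = "(+) v ` (V\<^sup>\<bottom>)"
      \<comment> \<open>The origin projects to \<open>0\<close>, whereas every point of the fibre projects to \<open>v\<close>.\<close>
      have nz: "v + z \<noteq> 0" if "z \<in> V\<^sup>\<bottom>" for z
        using orth_proj_eqI[OF assms(5) vw(1) that]
          orth_proj_eqI[OF assms(5) subspace_0[OF assms(5)] subspace_0[OF W]] False
        by auto
      have "closed ?S"
        by (intro closed_translation closed_subspace W)
      moreover have "A \<inter> ?S \<noteq> {}"
        using \<open>x \<in> A\<close> vw by auto
      moreover have "continuous_on (A \<inter> ?S) ?mu"
        by (rule continuous_at_imp_continuous_on)
          (auto intro!: has_derivative_continuous[OF D] dest: nz)
      ultimately obtain y where y: "y \<in> A \<inter> ?S" "\<And>z. z \<in> ?S \<Longrightarrow> ?mu y \<le> ?mu z"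
        using minkowski_functional_min_on_closed[OF assms(1,2,4)] by blast
      then obtain u where u: "u \<in> V\<^sup>\<bottom>" "y = v + u"
        by blast
      have "((+) v has_derivative (\<lambda>h. h)) (at u)"
        by (auto intro!: derivative_eq_intros)
      then have "((\<lambda>z. ?mu (v + z)) has_derivative blinfun_apply (D (v + u))) (at u)"
        using D[OF nz[OF u(1)]]
        by (rule has_derivative_compose[where f = "(+) v" and f' = "\<lambda>h. h" and g = ?mu])
      then have "((\<lambda>z. ?mu (v + z)) has_derivative (\<lambda>h. 0)) (at u within V\<^sup>\<bottom>)"
        by (rule has_derivative_zero_at_min_on_subspace[OF W u(1)]) (simp add: y(2) flip: u(2))
      moreover have "?mu (v + u) \<le> 1"
        using y(1) by (simp add: le1 flip: u(2))
      ultimately show ?thesis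
        using vw(1) u(1) unfolding eta_def mem_Collect_eq prod.case by blast
    qed
    then show "orth_proj V x \<in> ?R"
      using orth_proj_eqI[OF assms(5) vw(1,2)] vw(3) by simp
  qed
qed

end
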